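(* Let $n\ge 2$. There is an online algorithm $\mathrm{ALG}$, which does not know the price distribution, such that for every instance in which the prices are i.i.d. or affiliated, $\mathbb{E}(\mathrm{ALG})\ge \frac12\cdot\frac{n-2}{n-1}\cdot\mathbb{E}(\mathrm{OPT})$.
   Context: Trading-prophet problem: there are $n$ periods; in period $i$ the price $X_i$ is revealed. An agent starts in period 1 without the item and can hold at most one unit of it. In each period, immediately after observing the price, the agent may buy the item (reward $-X_i$) if she does not hold it, sell it (reward $+X_i$) if she holds it, or pass. The profit of an algorithm is its total reward. $\mathrm{OPT}$ is the maximum total reward over all buy/sell decision sequences given full knowledge of the realized price sequence. The prices are i.i.d. if $X_1,\dots,X_n$ are i.i.d. draws from some (absolutely continuous) distribution $F$; they are affiliated if $X_j=x_j+y$ where $y\sim G$ and $x_1,\dots,x_n\sim F$ are all independent, for some distributions $F,G$. The algorithm has no knowledge of $F$ (or $G$); it only observes the prices online. *)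

theory Defs
  imports "HOL-Probability.Probability"
begin

datatype action = Buy | Sell | Pass

text \<open>The Boolean argument records whether the agent currently holds the item. She may still hold it
  at the end of a feasible sequence.\<close>

fun feasible :: "bool \<Rightarrow> action list \<Rightarrow> bool" where
  "feasible h [] \<longleftrightarrow> True"
| "feasible h (Buy # acts) \<longleftrightarrow> \<not> h \<and> feasible True acts"
| "feasible h (Sell # acts) \<longleftrightarrow> h \<and> feasible False acts"
| "feasible h (Pass # acts) \<longleftrightarrow> feasible h acts"

fun reward :: "action \<Rightarrow> real \<Rightarrow> real" where
  "reward Buy p = - p"
| "reward Sell p = p"
| "reward Pass p = 0"

definition total_reward :: "action list \<Rightarrow> real list \<Rightarrow> real" where
  "total_reward acts ps = sum_list (map2 reward acts ps)"

definition decision_seqs :: "nat \<Rightarrow> action list set" where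
  "decision_seqs n = {acts. length acts = n \<and> feasible False acts}"

definition OPT :: "real list \<Rightarrow> real" where
  "OPT ps = Max ((\<lambda>acts. total_reward acts ps) ` decision_seqs (length ps))"

lemma finite_decision_seqs: "finite (decision_seqs n)"
proof -
  have "UNIV = {Buy, Sell, Pass}"
    using action.exhaust by blast
  then have "finite (UNIV :: action set)"
    by (metis finite.emptyI finite_insert)
  from finite_lists_length_eq[OF this, of n] show ?thesis
    by (rule finite_subset[rotated]) (auto simp: decision_seqs_def)
qed

lemma decision_seqs_nonempty: "decision_seqs n \<noteq> {}"
proof -
  have "feasible False (replicate n Pass)"
    by (induction n) auto
  then have "replicate n Pass \<in> decision_seqs n"
    by (simp add: decision_seqs_def)
  then show ?thesis by blast
qed

text \<open>A deterministic strategy maps the prices observed so far (the current one included) to an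
  action. Whether the agent currently holds the item is determined by these prices, hence it is not
  a further argument.\<close>

type_synonym strategy = "real list \<Rightarrow> action"

definition run :: "strategy \<Rightarrow> real list \<Rightarrow> action list" where
  "run S ps = map (\<lambda>i. S (take i ps)) [1..<Suc (length ps)]"

definition online_algorithm :: "nat \<Rightarrow> strategy \<Rightarrow> bool" where
  "online_algorithm n S \<longleftrightarrow> (\<forall>ps. length ps = n \<longrightarrow> feasible False (run S ps))"

definition profit :: "strategy \<Rightarrow> real list \<Rightarrow> real" where
  "profit S ps = total_reward (run S ps) ps"

text \<open>Laws of the price vector, as measures on functions on \<open>{1..n}\<close>.\<close>

definition iid_law :: "nat \<Rightarrow> real measure \<Rightarrow> (nat \<Rightarrow> real) measure" where
  "iid_law n F = PiM {1..n} (\<lambda>_. F)"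

definition affiliated_law :: "nat \<Rightarrow> real measure \<Rightarrow> real measure \<Rightarrow> (nat \<Rightarrow> real) measure" where
  "affiliated_law n F G =
     distr (PiM {1..n} (\<lambda>_. F) \<Otimes>\<^sub>M G) (PiM {1..n} (\<lambda>_. borel))
       (\<lambda>(x, y). \<lambda>j\<in>{1..n}. x j + y)"

definition prices :: "nat \<Rightarrow> (nat \<Rightarrow> real) \<Rightarrow> real list" where
  "prices n X = map X [1..<Suc n]"

text \<open>A randomized algorithm draws a seed uniformly from the unit interval, independently of the
  prices, and then follows the strategy determined by that seed.\<close>

definition seed :: "real measure" where
  "seed = uniform_measure lborel {0..1}"

end

theory Submission
  imports Defs
begin

text \<open>With \<open>X (n + 1) = 0\<close>, the profit is the sum of \<open>X (i + 1) - X i\<close> over the periods \<open>i \<le> n\<close> after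
  which the item is held, and OPT collects exactly the positive increments. The algorithm holds the
  item after a period \<open>2 \<le> i < n\<close> iff the price has just fallen, one fair coin deciding all ties,
  and after period \<open>n\<close> iff \<open>X n < 0\<close>, which is optimal for the last increment. Both laws are
  exchangeable. Exchanging \<open>X (i - 1)\<close> and \<open>X i\<close> shows that period \<open>i\<close> yields half of the expected
  positive increment \<open>\<mu>\<close>, so the algorithm earns \<open>(n - 2) / 2 * \<mu>\<close> plus the last positive increment,
  against \<open>(n - 1) * \<mu>\<close> plus the same for OPT.\<close>

section \<open>Trading on a fixed price path\<close>

lemma total_reward_simps [simp]:
  "total_reward [] ps = 0"
  "total_reward acts [] = 0"
  "total_reward (a # acts) (p # ps) = reward a p + total_reward acts ps"
  by (simp_all add: total_reward_def)

text \<open>The appended price \<open>0\<close> lets an item bought at a negative price and never sold count as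
  sold for nothing.\<close>

fun foresight_gain :: "real list \<Rightarrow> real" where
  "foresight_gain [] = 0"
| "foresight_gain (p # ps) = max 0 (hd (ps @ [0]) - p) + foresight_gain ps"

text \<open>Value an item in hand at the current price. Trading is then neutral, and carrying the
  item to the next period gains at most the positive part of the increment. The induction needs both
  initial holding states \<open>b\<close>.\<close>

lemma total_reward_le_foresight_gain:
  assumes "length acts = length ps" "feasible b acts"
  shows "total_reward acts ps \<le> of_bool b * hd (ps @ [0]) + foresight_gain ps"
  using assms
proof (induction acts ps arbitrary: b rule: list_induct2)
  case (Cons a acts p ps)
  then show ?case
    using Cons.IH[of True] Cons.IH[of False] by (cases a; cases b) auto
qed simp

lemma foresight_gain_attained:
  "\<exists>acts. length acts = length ps \<and> feasible b acts \<and>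
     total_reward acts ps = of_bool b * hd (ps @ [0]) + foresight_gain ps"
proof (induction ps arbitrary: b)
  case (Cons p ps)
  \<comment> \<open>\<open>c\<close> is the state to leave the period in, namely holding iff the
    next price is higher (0 after the last period). The action \<open>a\<close> below moves from
    \<open>b\<close> to \<open>c\<close>.\<close>
  define c where "c \<longleftrightarrow> p < hd (ps @ [0])"
  obtain acts where acts: "length acts = length ps" "feasible c acts"
    "total_reward acts ps = of_bool c * hd (ps @ [0]) + foresight_gain ps"
    using Cons.IH by blast
  define a where "a = (if b = c then Pass else if c then Buy else Sell)"
  show ?case
    by (rule exI[of _ "a # acts"])
      (use acts in \<open>cases b; cases c; auto simp: a_def c_def max_def\<close>)
qed simp

lemma OPT_eq_foresight_gain: "OPT ps = foresight_gain ps"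
  unfolding OPT_def
proof (rule Max_eqI)
  show "finite ((\<lambda>acts. total_reward acts ps) ` decision_seqs (length ps))"
    by (simp add: finite_decision_seqs)
next
  fix y assume "y \<in> (\<lambda>acts. total_reward acts ps) ` decision_seqs (length ps)"
  then show "y \<le> foresight_gain ps"
    using total_reward_le_foresight_gain[of _ ps False] by (auto simp: decision_seqs_def)
next
  show "foresight_gain ps \<in> (\<lambda>acts. total_reward acts ps) ` decision_seqs (length ps)"
    using foresight_gain_attained[of ps False] by (auto simp: decision_seqs_def image_iff)
qed

text \<open>The start \<open>m\<close> varies so that prices can be peeled off the front. The base
  case leaves only \<open>X n\<close>, whose increment to the appended price 0 is the last
  term.\<close>

lemma foresight_gain_map:
  assumes "m \<le> n"
  shows "foresight_gain (map X [m..<Suc n]) =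
    (\<Sum>i\<in>{m..<n}. max 0 (X (Suc i) - X i)) + max 0 (- X n)"
  using assms
proof (induction m rule: inc_induct)
  case (step m)
  then have "[m..<Suc n] = m # [Suc m..<Suc n]" "[Suc m..<Suc n] = Suc m # [Suc (Suc m)..<Suc n]"
    by (auto simp: upt_conv_Cons simp del: upt_Suc)
  with step show ?case
    by (simp add: sum.atLeast_Suc_lessThan del: upt_Suc)
qed simp

lemma OPT_prices:
  assumes "n \<ge> 1"
  shows "OPT (prices n X) = (\<Sum>i\<in>{1..<n}. max 0 (X (Suc i) - X i)) + max 0 (- X n)"
  unfolding OPT_eq_foresight_gain prices_def using assms by (rule foresight_gain_map)

section \<open>Strategies given by a target holding state\<close>

definition follow :: "(real list \<Rightarrow> bool) \<Rightarrow> strategy" where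
  "follow h ps = (if h ps = h (butlast ps) then Pass else if h ps then Buy else Sell)"

fun holds_after :: "bool \<Rightarrow> action list \<Rightarrow> bool" where
  "holds_after h [] = h"
| "holds_after h (Buy # acts) = holds_after True acts"
| "holds_after h (Sell # acts) = holds_after False acts"
| "holds_after h (Pass # acts) = holds_after h acts"

lemma feasible_append:
  "feasible h (as @ bs) \<longleftrightarrow> feasible h as \<and> feasible (holds_after h as) bs"
  by (induction h as rule: feasible.induct) auto

lemma holds_after_append: "holds_after h (as @ bs) = holds_after (holds_after h as) bs"
  by (induction h as rule: feasible.induct) auto

lemma run_snoc: "run S (ps @ [p]) = run S ps @ [S (ps @ [p])]"
  by (auto simp: run_def)

lemma length_run [simp]: "length (run S ps) = length ps"
  by (simp add: run_def del: upt_Suc)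

text \<open>That the actual holding state agrees with \<open>h\<close> is the invariant that carries
  feasibility through the induction. The assumption on \<open>h []\<close> matches starting without
  the item.\<close>

lemma feasible_run_follow:
  assumes "\<not> h []"
  shows "feasible False (run (follow h) ps) \<and> holds_after False (run (follow h) ps) = h ps"
proof (induction ps rule: rev_induct)
  case Nil
  then show ?case using assms by (simp add: run_def)
next
  case (snoc p ps)
  then show ?case
    by (auto simp: run_snoc feasible_append holds_after_append follow_def)
qed

lemma profit_snoc: "profit S (ps @ [p]) = profit S ps + reward (S (ps @ [p])) p"
  by (simp add: profit_def run_snoc total_reward_def)

lemma profit_follow_snoc:
  "profit (follow h) (ps @ [p]) =
     profit (follow h) ps + (of_bool (h ps) - of_bool (h (ps @ [p]))) * p"
  by (simp add: profit_snoc follow_def)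

lemma prices_Suc: "prices (Suc n) X = prices n X @ [X (Suc n)]"
  by (simp add: prices_def)

lemma prices_0 [simp]: "prices 0 X = []"
  by (simp add: prices_def)

lemma length_prices [simp]: "length (prices n X) = n"
  by (simp add: prices_def)

text \<open>Summation by parts: the cash flows are regrouped by the periods after which the item is
  held. Since \<open>h []\<close> is false, the only boundary term is the price at the end.\<close>

lemma profit_follow_prices:
  assumes "\<not> h []"
  shows "profit (follow h) (prices (Suc m) X) =
    (\<Sum>i\<in>{1..m}. of_bool (h (prices i X)) * (X (Suc i) - X i))
      - of_bool (h (prices (Suc m) X)) * X (Suc m)"
proof (induction m)
  case 0
  have "profit (follow h) [] = 0"
    by (simp add: profit_def run_def)
  then show ?case
    using assms profit_follow_snoc[of h "[]" "X 1"] by (simp add: prices_Suc)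
next
  case (Suc m)
  have "profit (follow h) (prices (Suc (Suc m)) X) = profit (follow h) (prices (Suc m) X) +
    (of_bool (h (prices (Suc m) X)) - of_bool (h (prices (Suc (Suc m)) X))) * X (Suc (Suc m))"
    by (subst (1 3) prices_Suc) (rule profit_follow_snoc)
  with Suc show ?case
    by (simp add: algebra_simps)
qed

section \<open>Holding after a dip\<close>

text \<open>The coin \<open>c\<close> decides whether an unchanged price counts as a fall. Ties can
  have positive probability, since in the affiliated case \<open>F\<close> may have atoms.\<close>

definition dip :: "bool \<Rightarrow> real \<Rightarrow> real \<Rightarrow> bool" where
  "dip c x y \<longleftrightarrow> y < x \<or> c \<and> y = x"

definition dip_rule :: "nat \<Rightarrow> bool \<Rightarrow> real list \<Rightarrow> bool" where
  "dip_rule n c ps \<longleftrightarrow> 2 \<le> length ps \<and>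
     (if length ps = n then last ps < 0
      else dip c (ps ! (length ps - 2)) (ps ! (length ps - 1)))"

lemma dip_rule_Nil [simp]: "\<not> dip_rule n c []"
  by (simp add: dip_rule_def)

text \<open>Summand \<open>i\<close> belongs to the increment after period \<open>Suc i\<close>, the
  first one with a preceding price being period 2; hence \<open>n - 2\<close> summands.\<close>

definition dip_gain :: "nat \<Rightarrow> bool \<Rightarrow> (nat \<Rightarrow> real) \<Rightarrow> real" where
  "dip_gain n c X =
     (\<Sum>i\<in>{1..<n - 1}. of_bool (dip c (X i) (X (Suc i))) * (X (Suc (Suc i)) - X (Suc i)))
       + max 0 (- X n)"

lemma dip_rule_prices:
  assumes "1 \<le> i" "Suc i < n"
  shows "dip_rule n c (prices (Suc i) X) \<longleftrightarrow> dip c (X i) (X (Suc i))"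
proof -
  have "prices (Suc i) X ! (i - 1) = X i" "prices (Suc i) X ! i = X (Suc i)"
    using assms unfolding prices_def by (subst nth_map; simp del: upt_Suc)+
  then show ?thesis
    using assms by (simp add: dip_rule_def)
qed

lemma dip_rule_prices_last:
  assumes "2 \<le> n"
  shows "dip_rule n c (prices n X) \<longleftrightarrow> X n < 0"
  using assms by (cases n) (auto simp: dip_rule_def prices_Suc)

lemma profit_dip_rule:
  assumes "2 \<le> n"
  shows "profit (follow (dip_rule n c)) (prices n X) = dip_gain n c X"
proof -
  obtain m where m: "n = Suc (Suc m)"
    using assms by (metis Suc_le_D numeral_2_eq_2 Suc_le_mono)
  \<comment> \<open>Period 1 contributes nothing, because the rule demands two observed prices; the
    remaining indices are shifted by one.\<close>
  have "(\<Sum>i\<in>{1..Suc m}. of_bool (dip_rule n c (prices i X)) * (X (Suc i) - X i)) =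
    (\<Sum>i\<in>{1..m}. of_bool (dip_rule n c (prices (Suc i) X)) * (X (Suc (Suc i)) - X (Suc i)))"
    by (subst sum.atLeast_Suc_atMost, simp, subst sum.shift_bounds_cl_Suc_ivl)
      (simp add: dip_rule_def)
  also have "\<dots> = (\<Sum>i\<in>{1..<n - 1}. of_bool (dip c (X i) (X (Suc i))) * (X (Suc (Suc i)) - X (Suc i)))"
    by (rule sum.cong) (auto simp: m dip_rule_prices)
  finally show ?thesis
    using dip_rule_prices_last[OF assms, of c X]
    by (auto simp: m profit_follow_prices dip_gain_def max_def)
qed

section \<open>Exchangeable prices\<close>

text \<open>Separates the coin from the prices when the profit is averaged over the seed.\<close>

lemma integral_times_integral:
  fixes f :: "'a \<Rightarrow> real" and g :: "'b \<Rightarrow> real"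
  assumes "prob_space M" "prob_space N" and f: "integrable M f" and g: "integrable N g"
  shows "integrable (M \<Otimes>\<^sub>M N) (\<lambda>(x, y). f x * g y)"
    and "(\<integral>(x, y). f x * g y \<partial>(M \<Otimes>\<^sub>M N)) = (\<integral>x. f x \<partial>M) * (\<integral>y. g y \<partial>N)"
proof -
  interpret M: prob_space M by fact
  interpret N: prob_space N by fact
  interpret pair_prob_space M N ..
  have [measurable]: "f \<in> borel_measurable M" "g \<in> borel_measurable N"
    using f g by auto
  show int: "integrable (M \<Otimes>\<^sub>M N) (\<lambda>(x, y). f x * g y)"
    by (rule Fubini_integrable) (use f g in \<open>auto simp: abs_mult\<close>)
  show "(\<integral>(x, y). f x * g y \<partial>(M \<Otimes>\<^sub>M N)) = (\<integral>x. f x \<partial>M) * (\<integral>y. g y \<partial>N)"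
    by (subst integral_fst'[OF int, symmetric]) simp
qed

text \<open>Exchangeability is what the two price models share; a common shift destroys independence
  but not this symmetry. The permuted path is restricted to \<open>{1..n}\<close> because points of
  \<open>PiM\<close> are extensional.\<close>

locale exchangeable = prob_space P for P :: "(nat \<Rightarrow> real) measure" +
  fixes n :: nat
  assumes sets_P [measurable_cong]: "sets P = sets (PiM {1..n} (\<lambda>_. borel))"
    and distr_permute: "\<And>\<sigma>. \<sigma> permutes {1..n} \<Longrightarrow>
      distr P (PiM {1..n} (\<lambda>_. borel)) (\<lambda>X. \<lambda>i\<in>{1..n}. X (\<sigma> i)) = P"
begin

lemma measurable_price: "i \<in> {1..n} \<Longrightarrow> (\<lambda>X. X i) \<in> borel_measurable P"
  by (subst measurable_cong_sets[OF sets_P refl]) (rule measurable_component_singleton)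

lemma measurable_permute:
  assumes "\<sigma> permutes {1..n}"
  shows "(\<lambda>X. \<lambda>i\<in>{1..n}. X (\<sigma> i)) \<in> measurable P (PiM {1..n} (\<lambda>_. borel))"
  by (intro measurable_restrict measurable_price) (simp only: permutes_in_image[OF assms])

lemma
  fixes f :: "(nat \<Rightarrow> real) \<Rightarrow> real"
  assumes "\<sigma> permutes {1..n}" and f: "f \<in> borel_measurable P"
  shows integral_permute: "(\<integral>X. f (\<lambda>i\<in>{1..n}. X (\<sigma> i)) \<partial>P) = (\<integral>X. f X \<partial>P)"
    and integrable_permute: "integrable P (\<lambda>X. f (\<lambda>i\<in>{1..n}. X (\<sigma> i))) \<longleftrightarrow> integrable P f"
proof -
  have f': "f \<in> borel_measurable (PiM {1..n} (\<lambda>_. borel))"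
    using f by (simp add: measurable_cong_sets[OF sets_P refl])
  note * = measurable_permute[OF assms(1)]
  show "(\<integral>X. f (\<lambda>i\<in>{1..n}. X (\<sigma> i)) \<partial>P) = (\<integral>X. f X \<partial>P)"
    using integral_distr[OF * f'] by (simp add: distr_permute assms del: One_nat_def)
  show "integrable P (\<lambda>X. f (\<lambda>i\<in>{1..n}. X (\<sigma> i))) \<longleftrightarrow> integrable P f"
    using integrable_distr_eq[OF * f'] by (simp add: distr_permute assms del: One_nat_def)
qed

lemma swap_pair:
  fixes g :: "real \<Rightarrow> real \<Rightarrow> real"
  assumes "i \<in> {1..n}" "j \<in> {1..n}" and g: "(\<lambda>(x, y). g x y) \<in> borel_measurable (borel \<Otimes>\<^sub>M borel)"
  shows "(\<integral>X. g (X j) (X i) \<partial>P) = (\<integral>X. g (X i) (X j) \<partial>P)"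
    and "integrable P (\<lambda>X. g (X j) (X i)) \<longleftrightarrow> integrable P (\<lambda>X. g (X i) (X j))"
proof -
  note [measurable] = measurable_price[OF assms(1)] measurable_price[OF assms(2)]
  have m: "(\<lambda>X. g (X i) (X j)) \<in> borel_measurable P"
    using measurable_compose[OF _ g, of "\<lambda>X. (X i, X j)" P] by simp
  have p: "Transposition.transpose i j permutes {1..n}"
    using assms by (simp add: permutes_swap_id)
  show "(\<integral>X. g (X j) (X i) \<partial>P) = (\<integral>X. g (X i) (X j) \<partial>P)"
    using integral_permute[OF p m] assms by simp
  show "integrable P (\<lambda>X. g (X j) (X i)) \<longleftrightarrow> integrable P (\<lambda>X. g (X i) (X j))"
    using integrable_permute[OF p m] assms by simp
qed

lemma swap_triple:
  fixes g :: "real \<Rightarrow> real \<Rightarrow> real \<Rightarrow> real"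
  assumes "i \<in> {1..n}" "j \<in> {1..n}" "k \<in> {1..n}" "k \<noteq> i" "k \<noteq> j"
    and g: "(\<lambda>(x, y, z). g x y z) \<in> borel_measurable (borel \<Otimes>\<^sub>M borel \<Otimes>\<^sub>M borel)"
  shows "(\<integral>X. g (X j) (X i) (X k) \<partial>P) = (\<integral>X. g (X i) (X j) (X k) \<partial>P)"
proof -
  note [measurable] = measurable_price[OF assms(1)] measurable_price[OF assms(2)]
    measurable_price[OF assms(3)]
  have m: "(\<lambda>X. g (X i) (X j) (X k)) \<in> borel_measurable P"
    using measurable_compose[OF _ g, of "\<lambda>X. (X i, X j, X k)" P] by simp
  have p: "Transposition.transpose i j permutes {1..n}"
    using assms by (simp add: permutes_swap_id)
  show ?thesis
    using integral_permute[OF p m] assms by simp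
qed

text \<open>A swap turns the positive part of the difference into its negative part. Differences are
  used throughout because the prices themselves need not be integrable: a shift with a heavy upper
  tail is allowed.\<close>

lemma integrable_diff:
  assumes "i \<in> {1..n}" "j \<in> {1..n}" and int: "integrable P (\<lambda>X. max 0 (X j - X i))"
  shows "integrable P (\<lambda>X. X j - X i)"
proof -
  have "integrable P (\<lambda>X. max 0 (X i - X j))"
    using swap_pair(2)[OF assms(1,2), of "\<lambda>x y. max 0 (y - x)"] int by simp
  with int have "integrable P (\<lambda>X. max 0 (X j - X i) - max 0 (X i - X j))"
    by (rule Bochner_Integration.integrable_diff)
  then show ?thesis
    by (rule Bochner_Integration.integrable_cong[THEN iffD1, rotated -1]) (auto simp: max_def)
qed

text \<open>Swapping the two prices negates the integrand, so the integral equals its own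
  negative.\<close>

lemma expectation_diff_eq_0:
  assumes "i \<in> {1..n}" "j \<in> {1..n}"
  shows "(\<integral>X. X j - X i \<partial>P) = 0"
proof -
  have "(\<integral>X. X j - X i \<partial>P) = (\<integral>X. X i - X j \<partial>P)"
    using swap_pair(1)[OF assms, of "\<lambda>x y. x - y"] by simp
  also have "\<dots> = (\<integral>X. - (X j - X i) \<partial>P)"
    by simp
  also have "\<dots> = - (\<integral>X. X j - X i \<partial>P)"
    by (rule integral_minus)
  finally show ?thesis by simp
qed

text \<open>Two transpositions move the pair down by one: first its members are exchanged, then
  \<open>Suc (Suc i)\<close> is replaced by \<open>i\<close> while \<open>Suc i\<close> stays
  fixed.\<close>

lemma expectation_rise_Suc:
  assumes "1 \<le> i" "Suc (Suc i) \<le> n"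
  shows "(\<integral>X. max 0 (X (Suc (Suc i)) - X (Suc i)) \<partial>P) = (\<integral>X. max 0 (X (Suc i) - X i) \<partial>P)"
proof -
  have "(\<integral>X. max 0 (X (Suc (Suc i)) - X (Suc i)) \<partial>P) =
      (\<integral>X. max 0 (X (Suc i) - X (Suc (Suc i))) \<partial>P)"
    using swap_pair(1)[of "Suc i" "Suc (Suc i)" "\<lambda>x y. max 0 (x - y)"] assms by simp
  also have "\<dots> = (\<integral>X. max 0 (X (Suc i) - X i) \<partial>P)"
    using swap_triple[of "Suc (Suc i)" i "Suc i" "\<lambda>x y z. max 0 (z - y)"] assms by simp
  finally show ?thesis .
qed

lemma expectation_rise:
  assumes "1 \<le> i" "i < n"
  shows "(\<integral>X. max 0 (X (Suc i) - X i) \<partial>P) = (\<integral>X. max 0 (X 2 - X 1) \<partial>P)"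
  using assms
proof (induction i rule: dec_induct)
  case base
  then show ?case by (simp add: numeral_2_eq_2)
next
  case (step i)
  then show ?case using expectation_rise_Suc[of i] by simp
qed

lemma integrable_dip_term:
  assumes "i \<in> {1..n}" "j \<in> {1..n}" and int: "integrable P (\<lambda>X. Z X :: real)"
  shows "integrable P (\<lambda>X. of_bool (dip c (X i) (X j)) * Z X)"
proof (rule Bochner_Integration.integrable_bound[OF int])
  have "(\<lambda>(x, y). of_bool (dip c x y) :: real) \<in> borel_measurable (borel \<Otimes>\<^sub>M borel)"
    unfolding dip_def of_bool_def by measurable
  from measurable_compose[OF measurable_Pair[OF measurable_price[OF assms(1)]
        measurable_price[OF assms(2)]] this]
  have "(\<lambda>X. of_bool (dip c (X i) (X j)) :: real) \<in> borel_measurable P"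
    by simp
  then show "(\<lambda>X. of_bool (dip c (X i) (X j)) * Z X) \<in> borel_measurable P"
    by (rule borel_measurable_times) (rule borel_measurable_integrable[OF int])
qed auto

text \<open>Swapping \<open>X i\<close> and \<open>X j\<close> and adding turns the integrands into
  \<open>X k - min (X i) (X j)\<close>, because
  \<open>dip False x y\<close> and \<open>dip True y x\<close> are complementary, also for \<open>x = y\<close>.\<close>

lemma expectation_dip_pair:
  assumes ij: "i \<in> {1..n}" "j \<in> {1..n}" and k: "k \<in> {1..n}" "k \<noteq> i" "k \<noteq> j"
    and int: "integrable P (\<lambda>X. X j - X i)" "integrable P (\<lambda>X. X k - X j)"
  shows "(\<integral>X. of_bool (dip False (X i) (X j)) * (X k - X j) \<partial>P) +
     (\<integral>X. of_bool (dip True (X i) (X j)) * (X k - X j) \<partial>P) = (\<integral>X. max 0 (X j - X i) \<partial>P)"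
proof -
  have int': "integrable P (\<lambda>X. X k - X i)"
    using Bochner_Integration.integrable_add[OF int] by simp
  define T where "T c i j X = of_bool (dip c (X i) (X j)) * (X k - X j)" for c i j and X :: "nat \<Rightarrow> real"
  have T_int: "integrable P (T c i j)" "integrable P (T c j i)" for c
    unfolding T_def using ij int int' by (auto intro!: integrable_dip_term)
  have swap: "integral\<^sup>L P (T c j i) = integral\<^sup>L P (T c i j)" for c
  proof -
    have "(\<lambda>(x, y, z). of_bool (dip c x y) * (z - y)) \<in> borel_measurable (borel \<Otimes>\<^sub>M borel \<Otimes>\<^sub>M borel)"
      unfolding dip_def of_bool_def by measurable
    from swap_triple[OF ij k this] show ?thesis
      unfolding T_def .
  qed
  have m_int: "integrable P (\<lambda>X. max 0 (X i - X j))"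
    using integrable_max[OF integrable_const[of 0] Bochner_Integration.integrable_minus[OF int(1)]]
    by simp
  have "2 * (integral\<^sup>L P (T False i j) + integral\<^sup>L P (T True i j)) =
    (\<integral>X. (T False i j X + T True j i X) + (T True i j X + T False j i X) \<partial>P)"
    using T_int swap by simp
  \<comment> \<open>Each bracket is \<open>X k - min (X i) (X j)\<close>. Measuring it from
    \<open>X i\<close> splits off \<open>X k - X i\<close>, which is integrable with expectation 0,
    and leaves a positive part.\<close>
  also have "\<dots> = (\<integral>X. 2 * ((X k - X i) + max 0 (X i - X j)) \<partial>P)"
    by (rule Bochner_Integration.integral_cong) (auto simp: T_def dip_def max_def)
  also have "\<dots> = 2 * (\<integral>X. max 0 (X i - X j) \<partial>P)"
    unfolding integral_mult_right_zero Bochner_Integration.integral_add[OF int' m_int]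
    using expectation_diff_eq_0[OF ij(1) k(1)] by simp
  also have "(\<integral>X. max 0 (X i - X j) \<partial>P) = (\<integral>X. max 0 (X j - X i) \<partial>P)"
    using swap_pair(1)[OF ij, of "\<lambda>x y. max 0 (x - y)"] by simp
  finally show ?thesis
    unfolding T_def by simp
qed

section \<open>Expected value of OPT against that of the dip rule\<close>

context
  assumes n: "2 \<le> n" and OPT_int: "integrable P (\<lambda>X. OPT (prices n X))"
begin

text \<open>OPT is a sum of nonnegative terms, so it dominates each of them.\<close>

lemma integrable_OPT_terms:
  shows integrable_rise: "\<And>i. 1 \<le> i \<Longrightarrow> i < n \<Longrightarrow> integrable P (\<lambda>X. max 0 (X (Suc i) - X i))"
    and integrable_last: "integrable P (\<lambda>X. max 0 (- X n))"
proof -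
  note OPT_int' = OPT_int[unfolded OPT_prices[OF order.trans[OF one_le_numeral n]]]
  show "integrable P (\<lambda>X. max 0 (- X n))"
  proof (rule Bochner_Integration.integrable_bound[OF OPT_int'])
    show "(\<lambda>X. max 0 (- X n)) \<in> borel_measurable P"
      using n measurable_price[of n] by simp
  qed (auto intro!: AE_I2 order.trans[OF _ abs_ge_self] add_increasing sum_nonneg)
  fix i assume i: "1 \<le> i" "i < n"
  show "integrable P (\<lambda>X. max 0 (X (Suc i) - X i))"
  proof (rule Bochner_Integration.integrable_bound[OF OPT_int'])
    show "(\<lambda>X. max 0 (X (Suc i) - X i)) \<in> borel_measurable P"
      using i measurable_price[of i] measurable_price[of "Suc i"] by simp
    have "max 0 (X (Suc i) - X i) \<le> (\<Sum>i\<in>{1..<n}. max 0 (X (Suc i) - X i))" for X :: "nat \<Rightarrow> real"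
      using i by (intro member_le_sum[of i _ "\<lambda>i. max 0 (X (Suc i) - X i)"]) auto
    then show "AE X in P. norm (max 0 (X (Suc i) - X i))
        \<le> norm ((\<Sum>i\<in>{1..<n}. max 0 (X (Suc i) - X i)) + max 0 (- X n))"
      by (intro AE_I2) (auto intro!: order.trans[OF _ abs_ge_self] add_increasing2)
  qed
qed

lemma expectation_OPT:
  "(\<integral>X. OPT (prices n X) \<partial>P) =
     (real n - 1) * (\<integral>X. max 0 (X 2 - X 1) \<partial>P) + (\<integral>X. max 0 (- X n) \<partial>P)"
proof -
  have "(\<integral>X. OPT (prices n X) \<partial>P) =
      (\<Sum>i\<in>{1..<n}. (\<integral>X. max 0 (X (Suc i) - X i) \<partial>P)) + (\<integral>X. max 0 (- X n) \<partial>P)"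
    unfolding OPT_prices[OF order.trans[OF one_le_numeral n]]
    by (subst Bochner_Integration.integral_add)
      (auto intro!: Bochner_Integration.integrable_sum integrable_OPT_terms
        Bochner_Integration.integral_sum)
  also have "(\<Sum>i\<in>{1..<n}. (\<integral>X. max 0 (X (Suc i) - X i) \<partial>P)) =
      (\<Sum>i\<in>{1..<n}. (\<integral>X. max 0 (X 2 - X 1) \<partial>P))"
    by (rule sum.cong) (use expectation_rise in auto)
  finally show ?thesis
    using n by (simp add: of_nat_diff)
qed

lemma integrable_diff_Suc: "1 \<le> i \<Longrightarrow> i < n \<Longrightarrow> integrable P (\<lambda>X. X (Suc i) - X i)"
  by (rule integrable_diff) (use integrable_rise in auto)

lemma integrable_dip_gain_term:
  assumes "i \<in> {1..<n - 1}"
  shows "integrable P (\<lambda>X. of_bool (dip c (X i) (X (Suc i))) * (X (Suc (Suc i)) - X (Suc i)))"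
  using assms integrable_diff_Suc[of "Suc i"] by (intro integrable_dip_term) auto

lemma integrable_dip_gain: "integrable P (dip_gain n c)"
  unfolding dip_gain_def
  using integrable_dip_gain_term integrable_last
  by (intro Bochner_Integration.integrable_add Bochner_Integration.integrable_sum) auto

text \<open>The two tie-breaks are evaluated only jointly, since \<open>expectation_dip_pair\<close>
  balances one against the other. The last increment is earned under both, hence the factor
  2.\<close>

lemma expectation_dip_gain:
  "(\<integral>X. dip_gain n False X \<partial>P) + (\<integral>X. dip_gain n True X \<partial>P) =
     (real n - 2) * (\<integral>X. max 0 (X 2 - X 1) \<partial>P) + 2 * (\<integral>X. max 0 (- X n) \<partial>P)"
proof -
  have gain: "(\<integral>X. dip_gain n c X \<partial>P) = (\<Sum>i\<in>{1..<n - 1}.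
      \<integral>X. of_bool (dip c (X i) (X (Suc i))) * (X (Suc (Suc i)) - X (Suc i)) \<partial>P) +
      (\<integral>X. max 0 (- X n) \<partial>P)" for c
    unfolding dip_gain_def
    by (simp only: Bochner_Integration.integral_add[OF
          Bochner_Integration.integrable_sum[OF integrable_dip_gain_term] integrable_last]
        Bochner_Integration.integral_sum[OF integrable_dip_gain_term])
  have "(\<integral>X. dip_gain n False X \<partial>P) + (\<integral>X. dip_gain n True X \<partial>P) =
      (\<Sum>i\<in>{1..<n - 1}.
        (\<integral>X. of_bool (dip False (X i) (X (Suc i))) * (X (Suc (Suc i)) - X (Suc i)) \<partial>P) +
        (\<integral>X. of_bool (dip True (X i) (X (Suc i))) * (X (Suc (Suc i)) - X (Suc i)) \<partial>P)) +
      2 * (\<integral>X. max 0 (- X n) \<partial>P)"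
    unfolding gain sum.distrib by simp
  also have "(\<Sum>i\<in>{1..<n - 1}.
        (\<integral>X. of_bool (dip False (X i) (X (Suc i))) * (X (Suc (Suc i)) - X (Suc i)) \<partial>P) +
        (\<integral>X. of_bool (dip True (X i) (X (Suc i))) * (X (Suc (Suc i)) - X (Suc i)) \<partial>P)) =
      (\<Sum>i\<in>{1..<n - 1}. (\<integral>X. max 0 (X 2 - X 1) \<partial>P))"
    by (rule sum.cong, simp, subst expectation_dip_pair)
      (use expectation_rise integrable_diff_Suc in auto)
  finally show ?thesis
    using n by (simp add: of_nat_diff)
qed

text \<open>The ratio \<open>q\<close> makes the rise terms on the two sides agree exactly. The last
  increment only adds slack: it is nonnegative, and \<open>q\<close> is at most 1 whereas the two
  coin outcomes earn it twice.\<close>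

lemma dip_gain_ratio:
  "((\<integral>X. dip_gain n False X \<partial>P) + (\<integral>X. dip_gain n True X \<partial>P)) / 2
     \<ge> 1 / 2 * ((real n - 2) / (real n - 1)) * (\<integral>X. OPT (prices n X) \<partial>P)"
proof -
  define \<mu> \<nu> q where "\<mu> = (\<integral>X. max 0 (X 2 - X 1) \<partial>P)"
    and "\<nu> = (\<integral>X. max 0 (- X n) \<partial>P)" and "q = (real n - 2) / (real n - 1)"
  note defs = \<mu>_def[symmetric] \<nu>_def[symmetric] q_def[symmetric]
  have "0 \<le> \<nu>"
    unfolding \<nu>_def by (rule integral_nonneg_AE) simp
  moreover have "q \<le> 1"
    using n by (simp add: q_def)
  ultimately have "q * \<nu> \<le> 2 * \<nu>"
    by (intro mult_right_mono) auto
  moreover have "q * ((real n - 1) * \<mu>) = (real n - 2) * \<mu>"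
    using n by (simp add: q_def)
  ultimately have "q * ((real n - 1) * \<mu> + \<nu>) \<le> (real n - 2) * \<mu> + 2 * \<nu>"
    by (simp only: distrib_left)
  moreover have "1 / 2 * q * y \<le> z / 2" if "q * y \<le> z" for y z
    using that by simp
  ultimately show ?thesis
    unfolding expectation_OPT expectation_dip_gain defs by blast
qed

end

text \<open>Without ties the coin has no effect; this yields the guarantee for each fixed
  seed.\<close>

lemma AE_dip_gain_eq:
  assumes "\<And>i j. i \<in> {1..n} \<Longrightarrow> j \<in> {1..n} \<Longrightarrow> i \<noteq> j \<Longrightarrow> AE X in P. X i \<noteq> X j"
  shows "AE X in P. dip_gain n c X = dip_gain n c' X"
proof -
  have "AE X in P. \<forall>i\<in>{1..<n - 1}. X i \<noteq> X (Suc i)"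
    by (intro eventually_ball_finite) (use assms in auto)
  then show ?thesis
    by eventually_elim (auto simp: dip_gain_def dip_def intro!: sum.cong)
qed

end

section \<open>Independent and affiliated prices\<close>

context
  fixes F :: "real measure"
  assumes F: "real_distribution F"
begin

interpretation F: real_distribution F by (rule F)

lemma sets_PiM_F: "sets (PiM I (\<lambda>_. F)) = sets (PiM I (\<lambda>_. borel))"
  by (rule sets_PiM_cong) auto

lemma measurable_PiM_F_component:
  assumes "i \<in> I"
  shows "(\<lambda>X. X i) \<in> borel_measurable (PiM I (\<lambda>_. F))"
  unfolding measurable_cong_sets[OF sets_PiM_F refl]
  using assms by (rule measurable_component_singleton)

lemma distr_PiM_permute:
  assumes "\<sigma> permutes I"
  shows "distr (PiM I (\<lambda>_. F)) (PiM I (\<lambda>_. F)) (\<lambda>X. \<lambda>i\<in>I. X (\<sigma> i)) = PiM I (\<lambda>_. F)"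
  using assms
  by (intro distr_PiM_reindex) (auto simp: permutes_inj_on permutes_in_image F.prob_space_axioms)

lemma exchangeable_iid: "exchangeable (iid_law n F) n"
proof -
  interpret prob_space "PiM {1..n} (\<lambda>_. F)"
    by (intro prob_space_PiM F.prob_space_axioms)
  show ?thesis
    unfolding iid_law_def
  proof
    show "sets (PiM {1..n} (\<lambda>_. F)) = sets (PiM {1..n} (\<lambda>_. borel))"
      by (rule sets_PiM_F)
    fix \<sigma> assume "\<sigma> permutes {1..n}"
    from distr_PiM_permute[OF this]
    show "distr (PiM {1..n} (\<lambda>_. F)) (PiM {1..n} (\<lambda>_. borel)) (\<lambda>X. \<lambda>i\<in>{1..n}. X (\<sigma> i)) =
        PiM {1..n} (\<lambda>_. F)"
      \<comment> \<open>The target spaces built from \<open>F\<close> and from \<open>borel\<close>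
        have the same measurable sets, and \<open>distr\<close> depends on its target only through
        these.\<close>
      by (subst distr_cong[OF refl sets_PiM_F[symmetric] refl])
  qed
qed

text \<open>Fubini: with coordinate \<open>i\<close> split off and the others fixed, it must avoid a
  single value, and \<open>F\<close> has no atoms.\<close>

lemma AE_iid_distinct:
  assumes ac: "absolutely_continuous lborel F"
    and ij: "i \<in> I" "j \<in> I" "i \<noteq> j"
  shows "AE X in PiM I (\<lambda>_. F). X i \<noteq> X j"
proof -
  define J where "J = I - {i}"
  have I: "I = insert i J" and j: "j \<in> J"
    using ij by (auto simp: J_def)
  interpret J: prob_space "PiM J (\<lambda>_. F)"
    by (intro prob_space_PiM F.prob_space_axioms)
  interpret pair_prob_space F "PiM J (\<lambda>_. F)" ..
  have [measurable]: "(\<lambda>Y. Y j) \<in> borel_measurable (PiM J (\<lambda>_. F))"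
    using j by (rule measurable_PiM_F_component)
  have null: "AE x in F. x \<noteq> y" for y
  proof (rule AE_I')
    show "{y} \<in> null_sets F"
      using ac null_setsI[OF emeasure_lborel_singleton, of y]
      by (auto simp: absolutely_continuous_def)
  qed auto
  have m_neq: "{p \<in> space (F \<Otimes>\<^sub>M PiM J (\<lambda>_. F)). fst p \<noteq> snd p j} \<in> sets (F \<Otimes>\<^sub>M PiM J (\<lambda>_. F))"
    by measurable
  \<comment> \<open>The quantifiers are exchanged so that \<open>Y\<close> is fixed first and
    \<open>null\<close> applies to the point \<open>Y j\<close>.\<close>
  have "AE x in F. AE Y in PiM J (\<lambda>_. F). x \<noteq> Y j"
    by (subst AE_commute[OF m_neq]) (use null in auto)
  then have *: "AE p in F \<Otimes>\<^sub>M PiM J (\<lambda>_. F). fst p \<noteq> snd p j"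
    using AE_pair_measure[OF m_neq] by simp
  have d: "distr (F \<Otimes>\<^sub>M PiM J (\<lambda>_. F)) (PiM I (\<lambda>_. F)) (\<lambda>(x, Y). Y(i := x)) = PiM I (\<lambda>_. F)"
    unfolding I by (intro distr_pair_PiM_eq_PiM F.prob_space_axioms)
  have neq: "{X \<in> space (PiM I (\<lambda>_. F)). X i \<noteq> X j} \<in> sets (PiM I (\<lambda>_. F))"
    using ij by (intro borel_measurable_neq measurable_PiM_F_component)
  have m: "(\<lambda>(x, Y). Y(i := x)) \<in> measurable (F \<Otimes>\<^sub>M PiM J (\<lambda>_. F)) (PiM I (\<lambda>_. F))"
    unfolding I by measurable
  have "AE X in distr (F \<Otimes>\<^sub>M PiM J (\<lambda>_. F)) (PiM I (\<lambda>_. F)) (\<lambda>(x, Y). Y(i := x)). X i \<noteq> X j"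
    by (subst AE_distr_iff[OF m neq]) (use * ij in \<open>auto simp: case_prod_beta\<close>)
  then show ?thesis
    unfolding d .
qed

section \<open>Prices with a common random shift\<close>

context
  fixes G :: "real measure"
  assumes G: "real_distribution G"
begin

interpretation G: real_distribution G by (rule G)

lemma measurable_affiliate:
  "(\<lambda>(x, y). \<lambda>j\<in>I. x j + y) \<in> measurable (PiM I (\<lambda>_. F) \<Otimes>\<^sub>M G) (PiM I (\<lambda>_. borel :: real measure))"
proof -
  have "(\<lambda>p. \<lambda>j\<in>I. fst p j + snd p) \<in> measurable (PiM I (\<lambda>_. F) \<Otimes>\<^sub>M G) (PiM I (\<lambda>_. borel :: real measure))"
  proof (rule measurable_restrict)
    fix j assume j: "j \<in> I"
    have [measurable]: "(\<lambda>Y. Y j) \<in> borel_measurable (PiM I (\<lambda>_. F))"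
      using j by (rule measurable_PiM_F_component)
    show "(\<lambda>p. fst p j + snd p) \<in> borel_measurable (PiM I (\<lambda>_. F) \<Otimes>\<^sub>M G)"
      by measurable
  qed
  then show ?thesis
    by (simp add: case_prod_beta')
qed

text \<open>Permuting coordinates commutes with adding a common shift, so the permutation can be
  moved onto the independent part, whose law is invariant.\<close>

lemma exchangeable_affiliated: "exchangeable (affiliated_law n F G) n"
proof -
  let ?Q = "PiM {1..n} (\<lambda>_. F)" and ?B = "PiM {1..n} (\<lambda>_. borel :: real measure)"
  let ?add = "\<lambda>(x, y). \<lambda>j\<in>{1..n}. x j + y :: real"
  interpret Q: prob_space ?Q
    by (intro prob_space_PiM F.prob_space_axioms)
  interpret pair_prob_space ?Q G ..
  interpret prob_space "distr (?Q \<Otimes>\<^sub>M G) ?B ?add"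
    by (rule prob_space_distr) (rule measurable_affiliate)
  show ?thesis
    unfolding affiliated_law_def
  proof
    show "sets (distr (?Q \<Otimes>\<^sub>M G) ?B ?add) = sets ?B"
      by simp
    fix \<sigma> assume \<sigma>: "\<sigma> permutes {1..n}"
    let ?p = "\<lambda>X :: nat \<Rightarrow> real. \<lambda>i\<in>{1..n}. X (\<sigma> i)"
    have pB: "?p \<in> measurable ?B ?B"
      by (intro measurable_restrict measurable_component_singleton)
        (simp only: permutes_in_image[OF \<sigma>])
    have pQ: "?p \<in> measurable ?Q ?Q"
      by (intro measurable_restrict measurable_component_singleton)
        (simp only: permutes_in_image[OF \<sigma>])
    have "distr (distr (?Q \<Otimes>\<^sub>M G) ?B ?add) ?B ?p = distr (?Q \<Otimes>\<^sub>M G) ?B (?p \<circ> ?add)"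
      by (rule distr_distr[OF pB measurable_affiliate])
    also have "?p \<circ> ?add = ?add \<circ> (\<lambda>(x, y). (?p x, y))"
      by (auto simp: fun_eq_iff permutes_in_image[OF \<sigma>] restrict_def
          simp del: One_nat_def atLeastAtMost_iff)
    also have "distr (?Q \<Otimes>\<^sub>M G) ?B (?add \<circ> (\<lambda>(x, y). (?p x, y))) =
        distr (distr (?Q \<Otimes>\<^sub>M G) (?Q \<Otimes>\<^sub>M G) (\<lambda>(x, y). (?p x, y))) ?B ?add"
      by (rule distr_distr[symmetric, OF measurable_affiliate]) (use pQ in measurable)
    also have "distr (?Q \<Otimes>\<^sub>M G) (?Q \<Otimes>\<^sub>M G) (\<lambda>(x, y). (?p x, y)) =
        distr ?Q ?Q ?p \<Otimes>\<^sub>M distr G G (\<lambda>y. y)"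
      by (rule pair_measure_distr[symmetric, OF pQ])
        (simp_all add: distr_id G.sigma_finite_measure_axioms)
    also have "\<dots> = ?Q \<Otimes>\<^sub>M G"
      by (simp only: distr_PiM_permute[OF \<sigma>] distr_id)
    finally show "distr (distr (?Q \<Otimes>\<^sub>M G) ?B ?add) ?B ?p = distr (?Q \<Otimes>\<^sub>M G) ?B ?add" .
  qed
qed

text \<open>The common shift cancels when two prices are compared, so \<open>G\<close> may be
  arbitrary and the claim reduces to \<open>AE_iid_distinct\<close>.\<close>

lemma AE_affiliated_distinct:
  assumes ac: "absolutely_continuous lborel F"
    and ij: "i \<in> {1..n}" "j \<in> {1..n}" "i \<noteq> j"
  shows "AE X in affiliated_law n F G. X i \<noteq> X j"
proof -
  interpret Q: prob_space "PiM {1..n} (\<lambda>_. F)"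
    by (intro prob_space_PiM F.prob_space_axioms)
  interpret pair_prob_space "PiM {1..n} (\<lambda>_. F)" G ..
  have [measurable]: "(\<lambda>X. X k) \<in> borel_measurable (PiM {1..n} (\<lambda>_. F))" if "k \<in> {1..n}" for k
    using that by (rule measurable_PiM_F_component)
  have 1: "{X \<in> space (PiM {1..n} (\<lambda>_. borel :: real measure)). X i \<noteq> X j} \<in> sets (PiM {1..n} (\<lambda>_. borel))"
    using ij by (intro borel_measurable_neq measurable_component_singleton)
  have 2: "{p \<in> space (PiM {1..n} (\<lambda>_. F) \<Otimes>\<^sub>M G). fst p i \<noteq> fst p j} \<in> sets (PiM {1..n} (\<lambda>_. F) \<Otimes>\<^sub>M G)"
    using ij by measurable
  have "AE x in PiM {1..n} (\<lambda>_. F). AE y in G. fst (x, y) i \<noteq> fst (x, y) j"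
    using AE_iid_distinct[OF ac ij] by eventually_elim simp
  from AE_pair_measure[OF 2 this] show ?thesis
    unfolding affiliated_law_def
    by (subst AE_distr_iff[OF measurable_affiliate 1]) (use ij in \<open>auto simp: case_prod_beta\<close>)
qed

end

end

section \<open>The guarantee\<close>

lemma prob_space_seed: "prob_space seed"
  unfolding seed_def by (rule prob_space_uniform_measure) simp_all

text \<open>Extracts a fair coin from the uniform seed.\<close>

lemma expectation_seed_coin: "(\<integral>r. of_bool (r < 1/2) \<partial>seed) = (1/2 :: real)"
  and integrable_seed_coin: "integrable seed (\<lambda>r. of_bool (r < 1/2) :: real)"
proof -
  interpret prob_space seed by (rule prob_space_seed)
  have s: "{..<1/2} \<in> sets seed"
    by (simp add: seed_def)
  have eq: "(\<lambda>r. of_bool (r < 1/2)) = (indicator {..<1/2} :: real \<Rightarrow> real)"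
    by (auto simp: fun_eq_iff indicator_def)
  have "{0..1} \<inter> {..<1/2} = {0..<1/2 :: real}"
    by auto
  then have "measure seed {..<1/2} = 1/2"
    unfolding seed_def by (subst measure_uniform_measure) simp_all
  then show "(\<integral>r. of_bool (r < 1/2) \<partial>seed) = (1/2 :: real)"
    unfolding eq using s by (simp add: seed_def)
  show "integrable seed (\<lambda>r. of_bool (r < 1/2) :: real)"
    unfolding eq using s by (simp add: integrable_indicator_iff less_top[symmetric])
qed


theorem theorem4:
  fixes n :: nat
  assumes "n \<ge> 2"
  shows "\<exists>ALG :: real \<Rightarrow> strategy.
    (\<forall>r. online_algorithm n (ALG r)) \<and>
    (\<forall>F G P.
       real_distribution F \<and> real_distribution G \<and>
       (absolutely_continuous lborel F \<and> P = iid_law n F \<or> P = affiliated_law n F G) \<and>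
       integrable P (\<lambda>X. OPT (prices n X)) \<longrightarrow>
         integrable (seed \<Otimes>\<^sub>M P) (\<lambda>(r, X). profit (ALG r) (prices n X)) \<and>
         (\<integral>(r, X). profit (ALG r) (prices n X) \<partial>(seed \<Otimes>\<^sub>M P))
           \<ge> 1 / 2 * ((real n - 2) / (real n - 1)) * (\<integral>X. OPT (prices n X) \<partial>P) \<and>
         (absolutely_continuous lborel F \<longrightarrow>
           (\<forall>r. integrable P (\<lambda>X. profit (ALG r) (prices n X)) \<and>
                (\<integral>X. profit (ALG r) (prices n X) \<partial>P)
                  \<ge> 1 / 2 * ((real n - 2) / (real n - 1)) * (\<integral>X. OPT (prices n X) \<partial>P))))"
\<comment> \<open>The seed enters only through the coin \<open>r < 1/2\<close>, which settles
  ties.\<close>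
proof (intro exI[of _ "\<lambda>r. follow (dip_rule n (r < 1/2))"] conjI allI impI; (elim conjE)?)
  fix r :: real
  show "online_algorithm n (follow (dip_rule n (r < 1/2)))"
    unfolding online_algorithm_def using feasible_run_follow by simp
next
  fix F G :: "real measure" and P
  assume FG: "real_distribution F" "real_distribution G"
    and law: "absolutely_continuous lborel F \<and> P = iid_law n F \<or> P = affiliated_law n F G"
    and OPT_int: "integrable P (\<lambda>X. OPT (prices n X))"
  interpret exchangeable P n
    using law exchangeable_iid[OF FG(1)] exchangeable_affiliated[OF FG] by auto
  interpret seed: prob_space seed
    by (rule prob_space_seed)
  let ?ratio = "1 / 2 * ((real n - 2) / (real n - 1)) * (\<integral>X. OPT (prices n X) \<partial>P)"
  note gain_int = integrable_dip_gain[OF assms OPT_int]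
  note gain_ratio = dip_gain_ratio[OF assms OPT_int]

  \<comment> \<open>On either side of the coin the profit becomes a function of \<open>r\<close>
    times a function of \<open>X\<close>, the shape that \<open>integral_times_integral\<close>
    needs.\<close>
  have mix: "(\<lambda>(r, X). profit (follow (dip_rule n (r < 1/2))) (prices n X)) =
    (\<lambda>p. (case p of (r, X) \<Rightarrow> of_bool (r < 1/2) * dip_gain n True X) +
         (case p of (r, X) \<Rightarrow> (1 - of_bool (r < 1/2)) * dip_gain n False X))"
    by (auto simp: fun_eq_iff profit_dip_rule[OF assms])
  have coin_int: "integrable seed (\<lambda>r. 1 - of_bool (r < 1/2) :: real)"
    by (intro Bochner_Integration.integrable_diff integrable_seed_coin) simp
  note heads = integral_times_integral[OF prob_space_seed prob_space_axioms
      integrable_seed_coin gain_int[of True]]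
  note tails = integral_times_integral[OF prob_space_seed prob_space_axioms
      coin_int gain_int[of False]]
  show "integrable (seed \<Otimes>\<^sub>M P) (\<lambda>(r, X). profit (follow (dip_rule n (r < 1/2))) (prices n X))"
    unfolding mix by (rule Bochner_Integration.integrable_add[OF heads(1) tails(1)])
  have "(\<integral>(r, X). profit (follow (dip_rule n (r < 1/2))) (prices n X) \<partial>(seed \<Otimes>\<^sub>M P)) =
      1/2 * (\<integral>X. dip_gain n True X \<partial>P) + (1 - 1/2) * (\<integral>X. dip_gain n False X \<partial>P)"
    unfolding mix Bochner_Integration.integral_add[OF heads(1) tails(1)] heads(2) tails(2)
    unfolding Bochner_Integration.integral_diff[OF seed.integrable_const integrable_seed_coin]
      expectation_seed_coin
    by (simp add: seed.prob_space)
  also have "\<dots> = ((\<integral>X. dip_gain n False X \<partial>P) + (\<integral>X. dip_gain n True X \<partial>P)) / 2"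
    by simp
  finally show "?ratio \<le> (\<integral>(r, X). profit (follow (dip_rule n (r < 1/2))) (prices n X) \<partial>(seed \<Otimes>\<^sub>M P))"
    using gain_ratio by (simp only:)

  fix r :: real
  show "integrable P (\<lambda>X. profit (follow (dip_rule n (r < 1/2))) (prices n X))"
    using gain_int by (simp add: profit_dip_rule[OF assms])
  assume ac: "absolutely_continuous lborel F"
  have "AE X in P. X i \<noteq> X j" if "i \<in> {1..n}" "j \<in> {1..n}" "i \<noteq> j" for i j
    using law AE_affiliated_distinct[OF FG ac that] AE_iid_distinct[OF FG(1) ac that]
    by (auto simp: iid_law_def simp del: One_nat_def)
  note ties = AE_dip_gain_eq[OF this]
  \<comment> \<open>Almost surely there are no ties, so both coin outcomes have the same
    expectation, which is therefore equal to their average.\<close>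
  have "(\<integral>X. dip_gain n c X \<partial>P) = (\<integral>X. dip_gain n c' X \<partial>P)" for c c'
    by (rule integral_cong_AE) (use gain_int ties[of c c'] in auto)
  from this[of True "r < 1/2"] this[of False "r < 1/2"] gain_ratio
  show "?ratio \<le> (\<integral>X. profit (follow (dip_rule n (r < 1/2))) (prices n X) \<partial>P)"
    by (simp add: profit_dip_rule[OF assms])
qed

end
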